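(* Let $N\ge 1$ and $K=K_1K_2$ with $K_1,K_2\ge 1$. Let $\gamma_{k,n}$ ($1\le k\le K$, $1\le n\le N$) be nonnegative random variables such that, for every $k$, $\gamma_{k,1},\dots,\gamma_{k,N}$ are independent and $\gamma_{k,n}$ has cumulative distribution function $$F_{\gamma_{k,n}}(\gamma)=\frac{1}{\Gamma(a_{k,n})}\Upsilon\!\left(a_{k,n},\sqrt{\frac{L_{n,1}^2L_{n,2}^2}{b_{k,n}^2}\frac{\gamma}{\bar\gamma}}\right),\qquad \gamma>0 .$$ Let $\gamma_{k,n^*}=\max_{1\le n\le N}\gamma_{k,n}$ and $\gamma_{\text{Max-Max}}=\max_{1\le k\le K}\gamma_{k,n^*}$. Let the dependence of $(\gamma_{1,n^*},\dots,\gamma_{K,n^*})$ be given by the Gaussian copula with correlation matrix $\Sigma=(\eta_{u,\tilde u})_{1\le u,\tilde u\le K}$, where for $u=f^{-1}(u_1,u_2)$ and $\tilde u=f^{-1}(\tilde u_1,\tilde u_2)$ $$\eta_{u,\tilde u}=\operatorname{sinc}\!\left(2\frac{|u_1-\tilde u_1|}{K_1-1}d_1+2\frac{|u_2-\tilde u_2|}{K_2-1}d_2\right).$$ Then for every $\gamma>0$ the cumulative distribution function of $\gamma_{\text{Max-Max}}$ is $$F_{\gamma_{\text{Max-Max}}}(\gamma)=\Phi_\Sigma\big(\Phi^{-1}(p_1(\gamma)),\dots,\Phi^{-1}(p_K(\gamma))\big),$$ where, for $1\le k\le K$, $$p_k(\gamma)=\prod_{n=1}^N\sum_{j=0}^\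infty\frac{(-1)^j\left(\frac{L_{n,1}^2L_{n,2}^2}{b_{k,n}^2}\frac{\gamma}{\bar\gamma}\right)^{\frac{a_{k,n}+j}{2}}}{j!\,(a_{k,n}+j)\,\Gamma(a_{k,n})}.$$
   Context: $\Gamma$ is the Gamma function and $\Upsilon(s,x)=\int_0^x t^{s-1}e^{-t}\,dt$ is the lower incomplete Gamma function. $\bar\gamma>0$ (average SNR), $L_{n,1},L_{n,2}>0$ (distances), $d_1,d_2>0$ (normalized side lengths of the antenna surface). $\gamma_{k,n}$ is the received SNR at port $k$ via the $n$-th reconfigurable intelligent surface (RIS), which has $M_n\ge 1$ elements. With Nakagami parameters (shape $m_{n,1},m_{k,n,2}\ge \tfrac12$, scale $\Omega_{n,1},\Omega_{k,n,2}>0$) set $m=m_{n,1}$, $m'=m_{k,n,2}$, $\Delta = m m'\Gamma(m)^2\Gamma(m')^2-\Gamma(m+\frac12)^2\Gamma(m'+\frac12)^2$; then $$a_{k,n}=\frac{m m' M_n\Gamma(m)^2\Gamma(m')^2}{\Delta}-M_n,\qquad b_{k,n}=\frac{\Delta}{\sqrt{m/\Omega_{n,1}}\,\Gamma(m)\Gamma(m+\frac12)\sqrt{m'/\Omega_{k,n,2}}\,\Gamma(m')\Gamma(m'+\frac12)},$$ and $a_{k,n},b_{k,n}>0$. $f:\{1,\dots,K\}\to\{1,\dots,K_1\}\times\{1,\dots,K_2\}$ is a fixed bijection, $f(u)=(u_1,u_2)$, indexing the ports of a $K_1\times K_2$ grid. $\operatorname{sinc}(t)=\frac{\sin(\pi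 t)}{\pi t}$ with $\operatorname{sinc}(0)=1$; a term with $K_i=1$ is read as $0$. $\Sigma$ is assumed to be a valid correlation matrix (positive semidefinite). $\Phi$ is the standard normal CDF, $\Phi^{-1}$ its inverse on $(0,1)$, and $\Phi_\Sigma(x_1,\dots,x_K)=\mathbb P(Z_1\le x_1,\dots,Z_K\le x_K)$ for $(Z_1,\dots,Z_K)$ multivariate normal with mean $\mathbf 0$ and covariance matrix $\Sigma$. A random vector $(X_1,\dots,X_K)$ with marginal CDFs $F_1,\dots,F_K$ has dependence given by the Gaussian copula with correlation matrix $\Sigma$ if $\mathbb P(X_1\le x_1,\dots,X_K\le x_K)=C(F_1(x_1),\dots,F_K(x_K))$, with $C(v_1,\dots,v_K)=\Phi_\Sigma(\Phi^{-1}(v_1),\dots,\Phi^{-1}(v_K))$ for $v_i\in(0,1)$. *)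

theory Defs
  imports "HOL-Probability.Probability"
begin

definition lower_incomplete_Gamma :: "real \<Rightarrow> real \<Rightarrow> real" where
  "lower_incomplete_Gamma s x = integral {0..x} (\<lambda>t. t powr (s - 1) * exp (- t))"

definition nakagami_Delta :: "real \<Rightarrow> real \<Rightarrow> real" where
  "nakagami_Delta m m' =
     m * m' * (Gamma m)\<^sup>2 * (Gamma m')\<^sup>2 - (Gamma (m + 1/2))\<^sup>2 * (Gamma (m' + 1/2))\<^sup>2"

definition snr_shape :: "real \<Rightarrow> real \<Rightarrow> nat \<Rightarrow> real" where
  "snr_shape m m' r =
     m * m' * real r * (Gamma m)\<^sup>2 * (Gamma m')\<^sup>2 / nakagami_Delta m m' - real r"

definition snr_scale :: "real \<Rightarrow> real \<Rightarrow> real \<Rightarrow> real \<Rightarrow> real" where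
  "snr_scale m \<Omega> m' \<Omega>' =
     nakagami_Delta m m' /
       (sqrt (m / \<Omega>) * Gamma m * Gamma (m + 1/2) * sqrt (m' / \<Omega>') * Gamma m' * Gamma (m' + 1/2))"

definition axis_offset :: "nat \<Rightarrow> real \<Rightarrow> nat \<Rightarrow> nat \<Rightarrow> real" where
  "axis_offset k d i j = (if k = 1 then 0 else 2 * (\<bar>real i - real j\<bar> / (real k - 1)) * d)"

text \<open>The constant \<^term>\<open>sinc\<close> of the library is the unnormalized one, hence the factor \<^term>\<open>pi\<close>.\<close>

definition port_correlation ::
    "nat \<Rightarrow> nat \<Rightarrow> real \<Rightarrow> real \<Rightarrow> (nat \<Rightarrow> nat \<times> nat) \<Rightarrow> nat \<Rightarrow> nat \<Rightarrow> real" where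
  "port_correlation K1 K2 d1 d2 f u v =
     sinc (pi * (axis_offset K1 d1 (fst (f u)) (fst (f v)) + axis_offset K2 d2 (snd (f u)) (snd (f v))))"

definition psd_on :: "'i set \<Rightarrow> ('i \<Rightarrow> 'i \<Rightarrow> real) \<Rightarrow> bool" where
  "psd_on I S \<longleftrightarrow>
     (\<forall>i\<in>I. \<forall>j\<in>I. S i j = S j i) \<and> (\<forall>c. 0 \<le> (\<Sum>i\<in>I. \<Sum>j\<in>I. c i * S i j * c j))"

text \<open>
  A law on \<open>\<real>\<^sup>I\<close> is multivariate normal with mean \<open>0\<close> and covariance matrix \<open>S\<close> if every linear
  combination of the coordinates with coefficients \<open>c\<close> is distributed as \<open>N(0, \<sigma>\<^sup>2)\<close> with
  \<open>\<sigma>\<^sup>2 = c\<^sup>T S c\<close>. Writing \<open>N(0, \<sigma>\<^sup>2)\<close> as the law of \<open>\<sigma> W\<close> with \<open>W\<close> standard normal includes the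
  degenerate case \<open>\<sigma> = 0\<close>, which occurs for singular \<open>S\<close>.
\<close>

definition centered_normal :: "real \<Rightarrow> real measure" where
  "centered_normal v = distr std_normal_distribution borel (\<lambda>w. sqrt v * w)"

definition mv_normal :: "'i set \<Rightarrow> ('i \<Rightarrow> 'i \<Rightarrow> real) \<Rightarrow> ('i \<Rightarrow> real) measure \<Rightarrow> bool" where
  "mv_normal I S N \<longleftrightarrow>
     prob_space N \<and> sets N = sets (\<Pi>\<^sub>M i\<in>I. (borel :: real measure)) \<and>
     (\<forall>c. distr N borel (\<lambda>z. \<Sum>i\<in>I. c i * z i) =
            centered_normal (\<Sum>i\<in>I. \<Sum>j\<in>I. c i * S i j * c j))"

lemma psd_on_factor:
  assumes "finite I" "psd_on I S"
  shows "\<exists>A. \<forall>i\<in>I. \<forall>j\<in>I. S i j = (\<Sum>l\<in>I. A i l * A j l)"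
  using assms
proof (induction I arbitrary: S rule: finite_induct)
  case empty
  then show ?case by simp
next
  case (insert a I)
  have sym: "S i j = S j i" if "i \<in> insert a I" "j \<in> insert a I" for i j
    using insert.prems that unfolding psd_on_def by blast
  have expand: "(\<Sum>i\<in>insert a I. \<Sum>j\<in>insert a I. c i * S i j * c j) =
      S a a * (c a)\<^sup>2 + 2 * c a * (\<Sum>i\<in>I. S a i * c i) + (\<Sum>i\<in>I. \<Sum>j\<in>I. c i * S i j * c j)" for c
  proof -
    have "(\<Sum>i\<in>I. c i * S i a * c a) = (\<Sum>i\<in>I. c a * S a i * c i)"
      using sym by (intro sum.cong) auto
    then show ?thesis
      using insert.hyps
      by (simp add: sum.distrib power2_eq_square algebra_simps sum_distrib_left)
  qed
  have nonneg: "0 \<le> S a a * (c a)\<^sup>2 + 2 * c a * (\<Sum>i\<in>I. S a i * c i) +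
      (\<Sum>i\<in>I. \<Sum>j\<in>I. c i * S i j * c j)" for c
    using insert.prems unfolding psd_on_def expand by blast
  have diag: "0 \<le> S a a"
    using nonneg[of "\<lambda>i. if i = a then 1 else 0"] insert.hyps(2)
    by (simp add: if_distrib[where f = "\<lambda>x. _ * x"] if_distrib[where f = "\<lambda>x. x * _"]
        sum.delta insert.hyps(1) cong: if_cong)
  have zero: "S a j = 0" if "S a a = 0" "j \<in> I" for j
  proof (rule ccontr)
    assume nz: "S a j \<noteq> 0"
    define c where "c = (\<lambda>i. if i = a then - (S j j + 1) / (2 * S a j) else if i = j then 1 else 0)"
    have ca: "c a = - (S j j + 1) / (2 * S a j)" by (simp add: c_def)
    have cI: "c i = (if i = j then 1 else 0)" if "i \<in> I" for i
      using that insert.hyps(2) by (auto simp: c_def)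
    have s1: "(\<Sum>i\<in>I. S a i * c i) = S a j"
    proof -
      have "(\<Sum>i\<in>I. S a i * c i) = (\<Sum>i\<in>I. if i = j then S a i else 0)"
        by (intro sum.cong) (auto simp: cI)
      then show ?thesis using insert.hyps(1) \<open>j \<in> I\<close> by simp
    qed
    have s2: "(\<Sum>i\<in>I. \<Sum>k\<in>I. c i * S i k * c k) = S j j"
    proof -
      have "(\<Sum>i\<in>I. \<Sum>k\<in>I. c i * S i k * c k) = (\<Sum>i\<in>I. if i = j then (\<Sum>k\<in>I. if k = j then S i k else 0) else 0)"
        by (intro sum.cong) (auto simp: cI intro!: sum.cong)
      then show ?thesis using insert.hyps(1) \<open>j \<in> I\<close> by simp
    qed
    have "2 * c a * S a j = - (S j j + 1)" using nz by (simp add: ca)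
    then show False using nonneg[of c] that(1) unfolding s1 s2 by simp
  qed
  define T where "T i j = S i j - S a i * S a j / S a a" for i j
  have "psd_on I T"
    unfolding psd_on_def
  proof (intro conjI ballI allI)
    fix i j assume "i \<in> I" "j \<in> I"
    then show "T i j = T j i" using sym by (simp add: T_def)
  next
    fix c :: "'a \<Rightarrow> real"
    define s where "s = (\<Sum>i\<in>I. S a i * c i)"
    define c' where "c' = c(a := - s / S a a)"
    have c': "c' i = c i" if "i \<in> I" for i
      using that insert.hyps(2) by (auto simp: c'_def)
    have "(\<Sum>i\<in>I. \<Sum>j\<in>I. c i * T i j * c j) = (\<Sum>i\<in>I. \<Sum>j\<in>I. c i * S i j * c j) - s * s / S a a"
      unfolding s_def T_def sum_product
      by (simp add: algebra_simps sum_subtractf sum_divide_distrib)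
    also have "\<dots> = S a a * (c' a)\<^sup>2 + 2 * c' a * s + (\<Sum>i\<in>I. \<Sum>j\<in>I. c i * S i j * c j)"
      by (simp add: c'_def power2_eq_square field_simps)
    also have "\<dots> = S a a * (c' a)\<^sup>2 + 2 * c' a * (\<Sum>i\<in>I. S a i * c' i) +
        (\<Sum>i\<in>I. \<Sum>j\<in>I. c' i * S i j * c' j)"
      by (simp add: s_def c')
    also have "0 \<le> \<dots>" by (rule nonneg)
    finally show "0 \<le> (\<Sum>i\<in>I. \<Sum>j\<in>I. c i * T i j * c j)" .
  qed
  then obtain A where A: "\<And>i j. i \<in> I \<Longrightarrow> j \<in> I \<Longrightarrow> T i j = (\<Sum>l\<in>I. A i l * A j l)"
    using insert.IH by blast
  define B where "B i l = (if l = a then S a i / sqrt (S a a) else if i = a then 0 else A i l)" for i l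
  have main: "S i j = (\<Sum>l\<in>insert a I. B i l * B j l)" if "i \<in> insert a I" "j \<in> insert a I" for i j
  proof -
    have "(\<Sum>l\<in>I. B i l * B j l) = (\<Sum>l\<in>I. if i = a \<or> j = a then 0 else A i l * A j l)"
      using insert.hyps(2) by (intro sum.cong) (auto simp: B_def)
    also have "\<dots> = (if i = a \<or> j = a then 0 else T i j)"
      using that A by auto
    finally have "(\<Sum>l\<in>insert a I. B i l * B j l) =
        S a i * S a j / S a a + (if i = a \<or> j = a then 0 else T i j)"
      using insert.hyps diag by (simp add: B_def)
    also have "\<dots> = S i j"
    proof -
      have "S l a = S a l" if "l \<in> I" for l using sym that by blast
      then show ?thesis
        using that zero insert.hyps(2) by (cases "S a a = 0") (auto simp: T_def)
    qed
    finally show ?thesis by simp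
  qed
  then show ?case by blast
qed

lemma mv_normal_exists:
  assumes "finite I" "psd_on I S"
  shows "\<exists>N. mv_normal I S N"
proof -
  obtain A where A: "\<And>i j. i \<in> I \<Longrightarrow> j \<in> I \<Longrightarrow> S i j = (\<Sum>l\<in>I. A i l * A j l)"
    using psd_on_factor[OF assms] by blast
  interpret W: real_distribution std_normal_distribution
    by (rule real_dist_normal_dist)
  define P where "P = (\<Pi>\<^sub>M i\<in>I. std_normal_distribution)"
  interpret prob_space P
    unfolding P_def by (rule prob_space_PiM) (rule W.prob_space_axioms)
  have comp: "(\<lambda>w. w i) \<in> borel_measurable P" if "i \<in> I" for i
    using measurable_component_singleton[OF that, of "\<lambda>_. std_normal_distribution"] by (simp add: P_def)
  have coord: "distr P borel (\<lambda>w. w i) = std_normal_distribution" if "i \<in> I" for i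
  proof -
    have "distr P borel (\<lambda>w. w i) = distr P std_normal_distribution (\<lambda>w. w i)"
      by (intro distr_cong) auto
    then show ?thesis
      using distr_PiM_component[of I "\<lambda>_. std_normal_distribution" i] that W.prob_space_axioms assms(1)
      unfolding P_def by simp
  qed
  have indep: "indep_vars (\<lambda>_. borel) (\<lambda>i w. w i) I"
  proof (cases "I = {}")
    case True
    then show ?thesis by (simp add: indep_vars_def indep_sets_def)
  next
    case False
    have "distr P (\<Pi>\<^sub>M i\<in>I. borel) (\<lambda>w. \<lambda>i\<in>I. w i) = distr P P (\<lambda>w. w)"
      by (intro distr_cong) (auto simp: P_def space_PiM PiE_def extensional_restrict intro!: sets_PiM_cong)
    also have "\<dots> = (\<Pi>\<^sub>M i\<in>I. distr P borel (\<lambda>w. w i))"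
    proof -
      have "(\<Pi>\<^sub>M i\<in>I. distr P borel (\<lambda>w. w i)) = P"
        by (subst (2) P_def, rule PiM_cong) (simp_all add: coord)
      then show ?thesis by (simp add: distr_id)
    qed
    finally show ?thesis
      using indep_vars_iff_distr_eq_PiM'[OF False, where M' = "\<lambda>_. borel" and X = "\<lambda>i w. w i"] comp by simp
  qed
  define Z where "Z w = (\<lambda>i\<in>I. \<Sum>l\<in>I. A i l * w l)" for w
  have Z [measurable]: "Z \<in> P \<rightarrow>\<^sub>M (\<Pi>\<^sub>M i\<in>I. (borel :: real measure))"
    unfolding Z_def using comp
    by (intro measurable_restrict borel_measurable_sum borel_measurable_times borel_measurable_const) auto
  have char_scale: "char (distr M borel (\<lambda>w. d * X w)) t = char (distr M borel X) (t * d)"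
    if "X \<in> borel_measurable M" for M :: "'b measure" and X :: "'b \<Rightarrow> real" and d t
    using that by (simp add: char_def integral_distr mult.assoc)
  have law: "distr (distr P (\<Pi>\<^sub>M i\<in>I. borel) Z) borel (\<lambda>z. \<Sum>i\<in>I. c i * z i) =
      centered_normal (\<Sum>i\<in>I. \<Sum>j\<in>I. c i * S i j * c j)" for c
  proof -
    define d where "d l = (\<Sum>i\<in>I. c i * A i l)" for l
    have var: "(\<Sum>i\<in>I. \<Sum>j\<in>I. c i * S i j * c j) = (\<Sum>l\<in>I. (d l)\<^sup>2)"
    proof -
      have "(\<Sum>i\<in>I. \<Sum>j\<in>I. c i * S i j * c j) = (\<Sum>i\<in>I. \<Sum>j\<in>I. \<Sum>l\<in>I. c i * A i l * (c j * A j l))"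
        by (intro sum.cong) (simp_all add: A sum_distrib_left sum_distrib_right mult_ac)
      also have "\<dots> = (\<Sum>i\<in>I. \<Sum>l\<in>I. \<Sum>j\<in>I. c i * A i l * (c j * A j l))"
        by (intro sum.cong refl sum.swap)
      also have "\<dots> = (\<Sum>l\<in>I. \<Sum>i\<in>I. \<Sum>j\<in>I. c i * A i l * (c j * A j l))"
        by (rule sum.swap)
      also have "\<dots> = (\<Sum>l\<in>I. (d l)\<^sup>2)"
        by (simp add: d_def power2_eq_square sum_product)
      finally show ?thesis .
    qed
    have "(\<Sum>i\<in>I. c i * Z w i) = (\<Sum>l\<in>I. d l * w l)" for w
      unfolding d_def sum_distrib_right by (subst sum.swap) (simp add: Z_def sum_distrib_left mult_ac)
    then have "distr (distr P (\<Pi>\<^sub>M i\<in>I. borel) Z) borel (\<lambda>z. \<Sum>i\<in>I. c i * z i) =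
        distr P borel (\<lambda>w. \<Sum>l\<in>I. d l * w l)"
      by (subst distr_distr) (simp_all add: comp_def)
    also have "\<dots> = centered_normal (\<Sum>l\<in>I. (d l)\<^sup>2)"
      unfolding centered_normal_def
    proof (rule Levy_uniqueness)
      show "real_distribution (distr P borel (\<lambda>w. \<Sum>l\<in>I. d l * w l))"
        using comp by (intro real_distribution_distr borel_measurable_sum borel_measurable_times) auto
      show "real_distribution (distr std_normal_distribution borel (\<lambda>w. sqrt (\<Sum>l\<in>I. (d l)\<^sup>2) * w))"
        by (intro W.real_distribution_distr) simp
      show "char (distr P borel (\<lambda>w. \<Sum>l\<in>I. d l * w l)) =
          char (distr std_normal_distribution borel (\<lambda>w. sqrt (\<Sum>l\<in>I. (d l)\<^sup>2) * w))"
      proof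
        fix t
        have "indep_vars (\<lambda>_. borel) (\<lambda>l w. d l * w l) I"
          by (rule indep_vars_compose2[OF indep, where Y = "\<lambda>l x. d l * x"]) simp
        then have "char (distr P borel (\<lambda>w. \<Sum>l\<in>I. d l * w l)) t =
            (\<Prod>l\<in>I. char (distr P borel (\<lambda>w. d l * w l)) t)"
          by (rule char_distr_sum)
        also have "\<dots> = (\<Prod>l\<in>I. complex_of_real (exp (- (t * d l)\<^sup>2 / 2)))"
          by (intro prod.cong refl) (simp add: char_scale comp coord char_std_normal_distribution)
        also have "\<dots> = complex_of_real (exp (\<Sum>l\<in>I. - (t * d l)\<^sup>2 / 2))"
          by (simp add: exp_sum assms(1) flip: of_real_prod)
        also have "(\<Sum>l\<in>I. - (t * d l)\<^sup>2 / 2) = - (t * sqrt (\<Sum>l\<in>I. (d l)\<^sup>2))\<^sup>2 / 2"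
          by (simp add: power_mult_distrib sum_nonneg sum_negf sum_divide_distrib sum_distrib_left)
        also have "complex_of_real (exp \<dots>) =
            char (distr std_normal_distribution borel (\<lambda>w. sqrt (\<Sum>l\<in>I. (d l)\<^sup>2) * w)) t"
          by (subst char_scale) (simp_all add: char_std_normal_distribution distr_id2)
        finally show "char (distr P borel (\<lambda>w. \<Sum>l\<in>I. d l * w l)) t =
            char (distr std_normal_distribution borel (\<lambda>w. sqrt (\<Sum>l\<in>I. (d l)\<^sup>2) * w)) t" .
      qed
    qed
    finally show ?thesis by (simp only: var)
  qed
  then show ?thesis
    unfolding mv_normal_def by (intro exI[of _ "distr P (\<Pi>\<^sub>M i\<in>I. borel) Z"]) (simp add: prob_space_distr)
qed

text \<open>The choice is harmless: by the Cramer--Wold theorem the law is determined by \<open>S\<close>.\<close>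

definition mv_normal_cdf :: "'i set \<Rightarrow> ('i \<Rightarrow> 'i \<Rightarrow> real) \<Rightarrow> ('i \<Rightarrow> real) \<Rightarrow> real" where
  "mv_normal_cdf I S x =
     (let N = (SOME N. mv_normal I S N) in measure N {z \<in> space N. \<forall>i\<in>I. z i \<le> x i})"

definition std_normal_quantile :: "real \<Rightarrow> real" where
  "std_normal_quantile p = (THE x. cdf std_normal_distribution x = p)"

definition gaussian_copula :: "'i set \<Rightarrow> ('i \<Rightarrow> 'i \<Rightarrow> real) \<Rightarrow> ('i \<Rightarrow> real) \<Rightarrow> real" where
  "gaussian_copula I S v = mv_normal_cdf I S (\<lambda>i. std_normal_quantile (v i))"

text \<open>
  The quantile function is only meaningful on \<open>(0,1)\<close>, so the joint distribution function is
  prescribed at those points where all marginal distribution functions take values in \<open>(0,1)\<close>.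
\<close>

definition has_gaussian_copula ::
    "'a measure \<Rightarrow> 'i set \<Rightarrow> ('i \<Rightarrow> 'i \<Rightarrow> real) \<Rightarrow> ('i \<Rightarrow> 'a \<Rightarrow> real) \<Rightarrow> bool" where
  "has_gaussian_copula M I S X \<longleftrightarrow>
     (\<forall>x. (\<forall>i\<in>I. cdf (distr M borel (X i)) (x i) \<in> {0<..<1}) \<longrightarrow>
        measure M {\<omega> \<in> space M. \<forall>i\<in>I. X i \<omega> \<le> x i} =
          gaussian_copula I S (\<lambda>i. cdf (distr M borel (X i)) (x i)))"

end

theory Submission
  imports Defs
begin

(* Expanding exp(-t) under the integral sign turns the incomplete Gamma function into the stated
  series. By independence the distribution function of a maximum over the surfaces is the product
  of the individual ones, hence equal to p_k; each factor lies strictly between 0 and 1, so the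
  copula identity applies at the diagonal point, where the joint distribution function is that of
  the overall maximum. *)

text \<open>For \<open>a < 1\<close> the integrand is unbounded near 0, so continuity does not
  suffice. Integrability is inherited from Euler's integral for \<open>Gamma a\<close> over the
  half-line.\<close>

lemma integrable_lower_incomplete_Gamma:
  fixes a u v :: real
  assumes "a > 0" "0 \<le> u"
  shows "(\<lambda>t. t powr (a - 1) * exp (- t)) integrable_on {u..v}"
proof (rule integrable_on_subinterval)
  show "(\<lambda>t. t powr (a - 1) * exp (- t)) integrable_on {0..}"
    using has_integral_integrable[OF Gamma_integral_real[OF assms(1)]]
    by (simp add: exp_minus divide_inverse)
qed (use assms in auto)

text \<open>The increment is the integral over \<open>{u..v}\<close>. There \<open>exp (- t)\<close>
  is at least \<open>exp (- v)\<close>, so the increment is at least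
  \<open>exp (- v) * (v powr a - u powr a) / a\<close>, which is positive.\<close>

lemma lower_incomplete_Gamma_strict_mono:
  assumes "a > 0" "0 \<le> u" "u < v"
  shows "lower_incomplete_Gamma a u < lower_incomplete_Gamma a v"
proof -
  have powr_int: "((\<lambda>t. t powr (a - 1)) has_integral (w powr a / a)) {0..w}" if "w \<ge> 0" for w
    using has_integral_powr_from_0[of "a - 1" w] assms that by simp
  have powr_uv: "(\<lambda>t. t powr (a - 1)) integrable_on {u..v}"
    by (rule integrable_on_subinterval[OF has_integral_integrable[OF powr_int[of v]]])
      (use assms in auto)
  \<comment> \<open>The closed form \<open>powr_int\<close> covers only intervals starting at 0, so
    the integral over \<open>{u..v}\<close> is obtained as a difference of two of these.\<close>
  have "integral {0..u} (\<lambda>t. t powr (a - 1)) + integral {u..v} (\<lambda>t. t powr (a - 1)) =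
      integral {0..v} (\<lambda>t. t powr (a - 1))"
    by (rule Henstock_Kurzweil_Integration.integral_combine)
      (use assms powr_int[of v] in \<open>auto intro: has_integral_integrable\<close>)
  then have "integral {u..v} (\<lambda>t. t powr (a - 1)) = (v powr a - u powr a) / a"
    using powr_int[of u] powr_int[of v] assms by (simp add: integral_unique diff_divide_distrib)
  also have "\<dots> > 0"
    using assms powr_less_mono2[of a u v] by simp
  finally have "0 < exp (- v) * integral {u..v} (\<lambda>t. t powr (a - 1))"
    by simp
  also have "\<dots> = integral {u..v} (\<lambda>t. t powr (a - 1) * exp (- v))"
    by (simp add: mult.commute)
  also have "\<dots> \<le> integral {u..v} (\<lambda>t. t powr (a - 1) * exp (- t))"
    using assms powr_uv
    by (intro integral_le integrable_lower_incomplete_Gamma integrable_on_mult_left mult_left_mono) auto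
  finally have "0 < integral {u..v} (\<lambda>t. t powr (a - 1) * exp (- t))" .
  moreover have "integral {0..u} (\<lambda>t. t powr (a - 1) * exp (- t)) +
      integral {u..v} (\<lambda>t. t powr (a - 1) * exp (- t)) =
      integral {0..v} (\<lambda>t. t powr (a - 1) * exp (- t))"
    by (rule Henstock_Kurzweil_Integration.integral_combine)
      (use assms integrable_lower_incomplete_Gamma[of a 0 v] in auto)
  ultimately show ?thesis
    unfolding lower_incomplete_Gamma_def by linarith
qed

lemma lower_incomplete_Gamma_pos:
  assumes "a > 0" "x > 0"
  shows "0 < lower_incomplete_Gamma a x"
  using lower_incomplete_Gamma_strict_mono[of a 0 x] assms by (simp add: lower_incomplete_Gamma_def)

lemma lower_incomplete_Gamma_less_Gamma:
  assumes "a > 0" "x \<ge> 0"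
  shows "lower_incomplete_Gamma a x < Gamma a"
proof -
  \<comment> \<open>Comparing with the integral over the half-line gives only a weak inequality.
    Strictness comes from the detour through a larger endpoint, and \<open>x + 1\<close> is an
    arbitrary choice.\<close>
  have "lower_incomplete_Gamma a x < lower_incomplete_Gamma a (x + 1)"
    using assms by (intro lower_incomplete_Gamma_strict_mono) auto
  also have "\<dots> \<le> Gamma a"
    unfolding lower_incomplete_Gamma_def
    using Gamma_integral_real[OF assms(1)] integrable_lower_incomplete_Gamma[OF assms(1), of 0 "x + 1"]
    by (intro has_integral_subset_le[of "{0..x + 1}" "{0..}" "\<lambda>t. t powr (a - 1) * exp (- t)"])
      (auto simp: exp_minus divide_inverse intro: integrable_integral)
  finally show ?thesis .
qed

text \<open>Termwise integration of the exponential series, justified by dominated convergence of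
  its partial sums with the integrable bound \<open>t powr (a - 1) * exp x\<close>.\<close>

lemma lower_incomplete_Gamma_sums:
  assumes "a > 0" "x \<ge> 0"
  shows "(\<lambda>j. (- 1) ^ j * x powr (a + real j) / (fact j * (a + real j))) sums
    lower_incomplete_Gamma a x"
proof -
  \<comment> \<open>\<open>g n\<close> is the integrand with \<open>exp (- t)\<close> cut off after
    \<open>n\<close> Taylor terms. The factor \<open>t powr (a - 1)\<close> is absorbed into each
    monomial, so that every term has an explicit integral.\<close>
  define g where "g n t = (\<Sum>j<n. (- 1) ^ j / fact j * t powr (a + real j - 1))" for n and t :: real
  have g_int: "(g n has_integral (\<Sum>j<n. (- 1) ^ j / fact j * (x powr (a + real j) / (a + real j)))) {0..x}"
    for n
    unfolding g_def
  proof (intro has_integral_sum has_integral_mult_right)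
    fix j
    show "((\<lambda>t. t powr (a + real j - 1)) has_integral x powr (a + real j) / (a + real j)) {0..x}"
      using has_integral_powr_from_0[of "a + real j - 1" x] assms by simp
  qed simp
  have g_eq: "g n t = t powr (a - 1) * (\<Sum>j<n. (- t) ^ j / fact j)" if "t \<ge> 0" for n t
  proof -
    \<comment> \<open>At \<open>t = 0\<close> both sides vanish, even for \<open>j = 0\<close>,
      because \<open>0 powr z = 0\<close> for every \<open>z\<close>.\<close>
    have "t powr (a + real j - 1) = t powr (a - 1) * t ^ j" for j
      using that powr_add[of t "a - 1" "real j"]
      by (cases "t = 0") (simp_all add: powr_realpow add_diff_eq diff_add_eq)
    then show ?thesis
      by (simp add: g_def sum_distrib_left power_minus[of t] mult_ac)
  qed
  have exp_sums: "(\<lambda>j. t ^ j / fact j) sums exp t" for t :: real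
    using exp_converges[of t] by (simp add: divide_inverse mult.commute)
  have bound: "norm (g n t) \<le> t powr (a - 1) * exp x" if "t \<in> {0..x}" for n t
  proof -
    \<comment> \<open>Dropping the alternating signs leaves a partial sum of the nonnegative series
      for \<open>exp t\<close>, hence a bound independent of \<open>n\<close>.\<close>
    have "\<bar>\<Sum>j<n. (- t) ^ j / fact j\<bar> \<le> (\<Sum>j<n. t ^ j / fact j)"
      by (rule order_trans[OF sum_abs]) (use that in \<open>simp add: power_abs\<close>)
    also have "\<dots> \<le> exp t"
      using sum_le_suminf[OF sums_summable[OF exp_sums[of t]], of "{..<n}"]
        sums_unique[OF exp_sums[of t]] that by simp
    also have "\<dots> \<le> exp x"
      using that by simp
    finally show ?thesis
      using that by (simp add: g_eq abs_mult mult_left_mono)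
  qed
  have "(\<lambda>n. integral {0..x} (g n)) \<longlonglongrightarrow> integral {0..x} (\<lambda>t. t powr (a - 1) * exp (- t))"
  proof (rule dominated_convergence(2))
    show "(\<lambda>t. t powr (a - 1) * exp x) integrable_on {0..x}"
      using has_integral_powr_from_0[of "a - 1" x] assms
      by (intro integrable_on_mult_left) (auto intro: has_integral_integrable)
    show "g n integrable_on {0..x}" for n
      using g_int by (rule has_integral_integrable)
    show "norm (g n t) \<le> t powr (a - 1) * exp x" if "t \<in> {0..x}" for n t
      using that by (rule bound)
    show "(\<lambda>n. g n t) \<longlonglongrightarrow> t powr (a - 1) * exp (- t)" if "t \<in> {0..x}" for t
      using that exp_sums[of "- t"] by (auto simp: g_eq sums_def intro!: tendsto_mult)
  qed
  moreover have "integral {0..x} (g n) =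
      (\<Sum>j<n. (- 1) ^ j * x powr (a + real j) / (fact j * (a + real j)))" for n
    by (simp add: integral_unique[OF g_int])
  ultimately show ?thesis
    by (simp add: sums_def lower_incomplete_Gamma_def)
qed

lemma (in prob_space) cdf_Max_indep_vars:
  fixes X :: "'i \<Rightarrow> 'a \<Rightarrow> real"
  assumes "finite I" "I \<noteq> {}" "indep_vars (\<lambda>_. borel) X I"
  shows "cdf (distr M borel (\<lambda>\<omega>. MAX i\<in>I. X i \<omega>)) x = (\<Prod>i\<in>I. cdf (distr M borel (X i)) x)"
proof -
  have rv: "random_variable borel (X i)" if "i \<in> I" for i
    using assms(3) that by (simp add: indep_vars_def)
  \<comment> \<open>This turns the event for the maximum into an intersection, to which independence
    applies. Non-emptiness of \<open>I\<close> gives \<open>Max\<close> its meaning.\<close>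
  have Max_le: "(MAX i\<in>I. X i \<omega>) \<le> x \<longleftrightarrow> (\<forall>i\<in>I. X i \<omega> \<le> x)" for \<omega>
    using assms(1,2) by simp
  have "cdf (distr M borel (\<lambda>\<omega>. MAX i\<in>I. X i \<omega>)) x = prob ((\<lambda>\<omega>. MAX i\<in>I. X i \<omega>) -` {..x} \<inter> space M)"
    unfolding cdf_def using assms rv by (intro measure_distr borel_measurable_Max) auto
  also have "(\<lambda>\<omega>. MAX i\<in>I. X i \<omega>) -` {..x} \<inter> space M = (\<Inter>i\<in>I. X i -` {..x} \<inter> space M)"
    using Max_le by (auto simp: assms(2))
  also have "prob \<dots> = (\<Prod>i\<in>I. prob (X i -` {..x} \<inter> space M))"
    using assms by (intro indep_varsD) auto
  also have "\<dots> = (\<Prod>i\<in>I. cdf (distr M borel (X i)) x)"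
    using rv by (intro prod.cong refl) (simp add: cdf_def measure_distr)
  finally show ?thesis .
qed

text \<open>Serves to exchange marginal distribution functions for \<open>p k x\<close>, an equality
  available only for ports \<open>k\<close> in \<open>{1..K}\<close>.\<close>

lemma mv_normal_cdf_cong:
  assumes "\<And>i. i \<in> I \<Longrightarrow> x i = z i"
  shows "mv_normal_cdf I S x = mv_normal_cdf I S z"
  using assms by (simp add: mv_normal_cdf_def cong: ball_cong)

text \<open>The first two conjuncts guard against default values: summability makes the infinite
  sums in \<open>p\<close> genuine limits, and \<open>p k x\<close> in \<open>(0,1)\<close> is the
  range on which \<open>std_normal_quantile\<close> is meaningful.\<close>

theorem proposition2:
  fixes M :: "'w measure"
    and N K K1 K2 :: nat
    and d1 d2 \<gamma>bar :: real
    and f :: "nat \<Rightarrow> nat \<times> nat"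
    and r :: "nat \<Rightarrow> nat"
    and L1 L2 m1 \<Omega>1 :: "nat \<Rightarrow> real"
    and m2 \<Omega>2 a b :: "nat \<Rightarrow> nat \<Rightarrow> real"
    and \<gamma> :: "nat \<Rightarrow> nat \<Rightarrow> 'w \<Rightarrow> real"
    and \<gamma>star :: "nat \<Rightarrow> 'w \<Rightarrow> real"
    and \<gamma>maxmax :: "'w \<Rightarrow> real"
    and \<Sigma> :: "nat \<Rightarrow> nat \<Rightarrow> real"
    and y :: "nat \<Rightarrow> nat \<Rightarrow> real \<Rightarrow> real"
    and q :: "nat \<Rightarrow> nat \<Rightarrow> real \<Rightarrow> nat \<Rightarrow> real"
    and p :: "nat \<Rightarrow> real \<Rightarrow> real"
  assumes "N \<ge> 1" "K1 \<ge> 1" "K2 \<ge> 1" "K = K1 * K2"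
    and "\<gamma>bar > 0" "d1 > 0" "d2 > 0"
    and "bij_betw f {1..K} ({1..K1} \<times> {1..K2})"
    and "\<And>n. n \<in> {1..N} \<Longrightarrow> r n \<ge> 1 \<and> L1 n > 0 \<and> L2 n > 0 \<and> m1 n \<ge> 1/2 \<and> \<Omega>1 n > 0"
    and "\<And>k n. k \<in> {1..K} \<Longrightarrow> n \<in> {1..N} \<Longrightarrow> m2 k n \<ge> 1/2 \<and> \<Omega>2 k n > 0"
    and a: "\<And>k n. a k n = snr_shape (m1 n) (m2 k n) (r n)"
    and b: "\<And>k n. b k n = snr_scale (m1 n) (\<Omega>1 n) (m2 k n) (\<Omega>2 k n)"
    and "\<And>k n. k \<in> {1..K} \<Longrightarrow> n \<in> {1..N} \<Longrightarrow> a k n > 0 \<and> b k n > 0"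
    and y: "\<And>k n x. y k n x = (L1 n)\<^sup>2 * (L2 n)\<^sup>2 / (b k n)\<^sup>2 * (x / \<gamma>bar)"
    and "prob_space M"
    and "\<And>k n. k \<in> {1..K} \<Longrightarrow> n \<in> {1..N} \<Longrightarrow> \<gamma> k n \<in> borel_measurable M"
    and "\<And>k n \<omega>. k \<in> {1..K} \<Longrightarrow> n \<in> {1..N} \<Longrightarrow> \<omega> \<in> space M \<Longrightarrow> \<gamma> k n \<omega> \<ge> 0"
    and "\<And>k. k \<in> {1..K} \<Longrightarrow> prob_space.indep_vars M (\<lambda>_. borel) (\<gamma> k) {1..N}"
    and "\<And>k n x. k \<in> {1..K} \<Longrightarrow> n \<in> {1..N} \<Longrightarrow> x > 0 \<Longrightarrow>
           cdf (distr M borel (\<gamma> k n)) x =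
             1 / Gamma (a k n) * lower_incomplete_Gamma (a k n) (sqrt (y k n x))"
    and \<gamma>star: "\<And>k \<omega>. \<gamma>star k \<omega> = (MAX n\<in>{1..N}. \<gamma> k n \<omega>)"
    and \<gamma>maxmax: "\<And>\<omega>. \<gamma>maxmax \<omega> = (MAX k\<in>{1..K}. \<gamma>star k \<omega>)"
    and \<Sigma>: "\<Sigma> = port_correlation K1 K2 d1 d2 f"
    and "psd_on {1..K} \<Sigma>"
    and "has_gaussian_copula M {1..K} \<Sigma> \<gamma>star"
    and q: "\<And>k n x j. q k n x j =
           (-1) ^ j * y k n x powr ((a k n + real j) / 2) /
             (fact j * (a k n + real j) * Gamma (a k n))"
    and p: "\<And>k x. p k x = (\<Prod>n=1..N. \<Sum>j. q k n x j)"
    and "x > 0"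
  shows "(\<forall>k\<in>{1..K}. \<forall>n\<in>{1..N}. summable (q k n x)) \<and>
         (\<forall>k\<in>{1..K}. p k x \<in> {0<..<1}) \<and>
         cdf (distr M borel \<gamma>maxmax) x =
           mv_normal_cdf {1..K} \<Sigma> (\<lambda>k. std_normal_quantile (p k x))"
proof -
  interpret prob_space M by fact
  have meas: "\<gamma> k n \<in> borel_measurable M" if "k \<in> {1..K}" "n \<in> {1..N}" for k n
    using assms(16) that by blast
  have series: "q k n x sums cdf (distr M borel (\<gamma> k n)) x \<and> cdf (distr M borel (\<gamma> k n)) x \<in> {0<..<1}"
    if k: "k \<in> {1..K}" and n: "n \<in> {1..N}" for k n
  proof -
    have ab: "a k n > 0" "b k n > 0" using assms(13)[OF k n] by auto
    have y_pos: "y k n x > 0"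
      using assms(9)[OF n] ab \<open>\<gamma>bar > 0\<close> \<open>x > 0\<close> unfolding y by simp
    have G: "Gamma (a k n) > 0" using ab by (simp add: Gamma_real_pos)
    have cdf: "cdf (distr M borel (\<gamma> k n)) x =
        lower_incomplete_Gamma (a k n) (sqrt (y k n x)) / Gamma (a k n)"
      using assms(19)[OF k n \<open>x > 0\<close>] by simp
    \<comment> \<open>The halved exponent of \<open>y k n x\<close> in \<open>q\<close> is a full
      power of its square root, so \<open>q\<close> is the incomplete Gamma series at the endpoint
      \<open>sqrt (y k n x)\<close>, normalized by \<open>Gamma (a k n)\<close>.\<close>
    have "q k n x = (\<lambda>j. (- 1) ^ j * sqrt (y k n x) powr (a k n + real j) /
        (fact j * (a k n + real j)) / Gamma (a k n))"
      using y_pos by (simp add: q powr_powr fun_eq_iff flip: powr_half_sqrt)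
    then have "q k n x sums cdf (distr M borel (\<gamma> k n)) x"
      using sums_divide[OF lower_incomplete_Gamma_sums[of "a k n" "sqrt (y k n x)"]] ab y_pos
      by (simp add: cdf)
    then show ?thesis
      using lower_incomplete_Gamma_pos[of "a k n" "sqrt (y k n x)"]
        lower_incomplete_Gamma_less_Gamma[of "a k n" "sqrt (y k n x)"] ab y_pos G
      by (simp add: cdf)
  qed
  have p_eq: "p k x = (\<Prod>n=1..N. cdf (distr M borel (\<gamma> k n)) x)" if "k \<in> {1..K}" for k
    unfolding p using series that by (intro prod.cong refl) (simp add: sums_iff)
  have p_range: "p k x \<in> {0<..<1}" if "k \<in> {1..K}" for k
  proof -
    \<comment> \<open>Strictness needs at least one factor, which \<open>N \<ge> 1\<close>
      supplies.\<close>
    have "(\<Prod>n=1..N. cdf (distr M borel (\<gamma> k n)) x) < (\<Prod>n=1..N. 1)"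
      using series that \<open>N \<ge> 1\<close> by (intro prod_mono_strict) (auto intro: less_imp_le)
    then show ?thesis
      using series that by (auto simp: p_eq intro!: prod_pos)
  qed
  have cdf_star: "cdf (distr M borel (\<gamma>star k)) x = p k x" if "k \<in> {1..K}" for k
  proof -
    have "\<gamma>star k = (\<lambda>\<omega>. MAX n\<in>{1..N}. \<gamma> k n \<omega>)"
      by (simp add: \<gamma>star fun_eq_iff)
    then show ?thesis
      using cdf_Max_indep_vars[of "{1..N}" "\<gamma> k" x] assms(18)[OF that] \<open>N \<ge> 1\<close> that
      by (simp add: p_eq)
  qed
  have "K \<ge> 1" using assms(2-4) by simp
  have "\<gamma>star k \<in> borel_measurable M" if "k \<in> {1..K}" for k
    unfolding \<gamma>star[abs_def] using meas that by (intro borel_measurable_Max) auto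
  then have "\<gamma>maxmax \<in> borel_measurable M"
    unfolding \<gamma>maxmax[abs_def] by (intro borel_measurable_Max) auto
  then have "cdf (distr M borel \<gamma>maxmax) x = prob (\<gamma>maxmax -` {..x} \<inter> space M)"
    by (simp add: cdf_def measure_distr)
  also have "\<gamma>maxmax -` {..x} \<inter> space M = {\<omega> \<in> space M. \<forall>k\<in>{1..K}. \<gamma>star k \<omega> \<le> x}"
    using \<open>K \<ge> 1\<close> by (auto simp: \<gamma>maxmax)
  \<comment> \<open>The copula hypothesis is evaluated at the constant vector \<open>x\<close>. Its
    premise, that all marginal values lie in \<open>(0,1)\<close>, follows from
    \<open>p_range\<close> through \<open>cdf_star\<close>.\<close>
  also have "prob \<dots> = gaussian_copula {1..K} \<Sigma> (\<lambda>k. cdf (distr M borel (\<gamma>star k)) x)"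
    using assms(24)[unfolded has_gaussian_copula_def, rule_format, of "\<lambda>_. x"] p_range cdf_star by simp
  also have "\<dots> = mv_normal_cdf {1..K} \<Sigma> (\<lambda>k. std_normal_quantile (p k x))"
    unfolding gaussian_copula_def by (intro mv_normal_cdf_cong) (simp add: cdf_star)
  finally show ?thesis
    using series p_range by (auto simp: sums_iff)
qed

end
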